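(* Let $\gamma>1$, $a>0$, $\pi(\varrho,s)=\varrho^{\gamma}\exp(as)$, and let $\varrho_\infty>0$, $s_\infty\in\mathbb{R}$ be constants. Let $[\mathbf{U},P]$ be a smooth solution of $$\mathbf{U}\cdot\nabla_x\mathbf{U}+\nabla_x P=0,\qquad \mathrm{div}_x\,\mathbf{U}=0,\qquad \mathbf{U}\cdot\nabla_x P=0\qquad\text{in }\mathbb{R}^3$$ with compactly supported velocity field $\mathbf{U}:\mathbb{R}^3\to\mathbb{R}^3$, and set $P_\infty=\lim_{|y|\to\infty}P(y)$. Let $b\le\inf_{x\in\mathbb{R}^3}P(x)$ with $b<P_\infty$, let $\varrho_0>0$, and let $\widetilde\varrho\in C^3(\mathbb{R})$ satisfy $$\widetilde\varrho(z)=\varrho_0\ \text{ for } z\le b,\qquad \widetilde\varrho(z)=\varrho_\infty\ \text{ for } z\ge P_\infty,\qquad \widetilde\varrho'(z)>0\ \text{ for } z\in(b,P_\infty).$$ Set $$\Psi(z)=\left(\frac{1}{\widetilde\varrho(z)}\,\frac{\mathrm{d}}{\mathrm{d}z}\pi\big(\widetilde\varrho(z),s_\infty\big)\right)^{1/2},\qquad \varrho=\widetilde\varrho(P),\qquad \mathbf{u}=\Psi(P)\mathbf{U}.$$ Then $[\varrho,\mathbf{u}]$ solves the isentropic stationary Euler system $$\mathrm{div}_x(\varrho\mathbf{u})=0,\qquad \mathrm{div}_x(\varrho\mathbf{u}\otimes\mathbf{u})+\nabla_x\pi(\varrho,s_\infty)=0\qquad\text{in }\mathbb{R}^3,$$ with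 $\mathbf{u}\to0$ and $\varrho\to\varrho_\infty$ as $|x|\to\infty$, and in addition $$\mathrm{div}_x\,\mathbf{u}=0,\qquad \mathbf{u}\cdot\nabla_x\varrho=0\qquad\text{in }\mathbb{R}^3.$$ In particular, $[\varrho,\mathbf{u}]$ also solves the stationary non-homogeneous incompressible Euler system in $\mathbb{R}^3$: $$\mathrm{div}_x\,\mathbf{u}=0,\qquad \mathrm{div}_x(\varrho\mathbf{u})=0,\qquad \varrho\,\mathbf{u}\cdot\nabla_x\mathbf{u}=-\nabla_x\Pi$$ for some scalar pressure function $\Pi$ on $\mathbb{R}^3$.
   Context: Here $\varrho$ is the mass density and $\mathbf{u}$ the velocity (with values in $\mathbb{R}^3$); $\pi(\varrho,s_\infty)$ is the pressure at constant entropy $s_\infty$. The notation $\Psi(P)$, $\widetilde\varrho(P)$ denotes composition, e.g. $\Psi(P)(x)=\Psi(P(x))$. For $[\mathbf U,P]$, "smooth" means $C^\infty$; solutions $[\varrho,\mathbf{u}]$ are understood in the classical sense ($C^1$ functions satisfying the equations pointwise). The limit $P_\infty$ exists, since $\nabla_xP=0$ outside the support of $\mathbf{U}$. *)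

theory Defs
  imports "HOL-Analysis.Analysis"
begin

text \<open>Class $C^k$ on the whole space: all iterated directional derivatives up to order $k$
  exist (in the Frechet sense) and are continuous.\<close>

primrec C_class :: "nat \<Rightarrow> ('a::euclidean_space \<Rightarrow> 'b::real_normed_vector) \<Rightarrow> bool" where
  "C_class 0 f \<longleftrightarrow> continuous_on UNIV f"
| "C_class (Suc k) f \<longleftrightarrow>
     (\<forall>x. f differentiable (at x)) \<and>
     (\<forall>v. C_class k (\<lambda>x. frechet_derivative f (at x) v))"

definition smooth :: "('a::euclidean_space \<Rightarrow> 'b::real_normed_vector) \<Rightarrow> bool" where
  "smooth f \<longleftrightarrow> (\<forall>k. C_class k f)"

definition partial :: "'n \<Rightarrow> (real^'n::finite \<Rightarrow> 'b::real_normed_vector) \<Rightarrow> real^'n \<Rightarrow> 'b" where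
  "partial j f x = frechet_derivative f (at x) (axis j 1)"

definition grad :: "(real^'n::finite \<Rightarrow> real) \<Rightarrow> real^'n \<Rightarrow> real^'n" where
  "grad f x = (\<chi> i. partial i f x)"

definition divergence :: "(real^'n::finite \<Rightarrow> real^'n) \<Rightarrow> real^'n \<Rightarrow> real" where
  "divergence V x = (\<Sum>j\<in>UNIV. partial j (\<lambda>y. V y $ j) x)"

definition tensor_divergence :: "(real^'n::finite \<Rightarrow> real^'n^'n) \<Rightarrow> real^'n \<Rightarrow> real^'n" where
  "tensor_divergence T x = (\<chi> i. \<Sum>j\<in>UNIV. partial j (\<lambda>y. T y $ i $ j) x)"

definition tensor_product :: "real^'n::finite \<Rightarrow> real^'n \<Rightarrow> real^'n^'n" where
  "tensor_product v w = (\<chi> i j. v $ i * w $ j)"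

text \<open>The convective derivative $(V \cdot \nabla_x) f$ of a scalar or vector field $f$.\<close>

definition convective ::
    "(real^'n::finite \<Rightarrow> real^'n) \<Rightarrow> (real^'n \<Rightarrow> 'b::real_normed_vector) \<Rightarrow> real^'n \<Rightarrow> 'b" where
  "convective V f x = (\<Sum>j\<in>UNIV. (V x $ j) *\<^sub>R partial j f x)"

definition pressure :: "real \<Rightarrow> real \<Rightarrow> real \<Rightarrow> real \<Rightarrow> real" where
  "pressure \<gamma> a \<rho> s = \<rho> powr \<gamma> * exp (a * s)"

definition isentropic_Euler ::
    "(real \<Rightarrow> real) \<Rightarrow> (real^'n::finite \<Rightarrow> real) \<Rightarrow> (real^'n \<Rightarrow> real^'n) \<Rightarrow> bool" where
  "isentropic_Euler p \<rho> u \<longleftrightarrow>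
     C_class 1 \<rho> \<and> C_class 1 u \<and>
     (\<forall>x. divergence (\<lambda>y. \<rho> y *\<^sub>R u y) x = 0) \<and>
     (\<forall>x. tensor_divergence (\<lambda>y. \<rho> y *\<^sub>R tensor_product (u y) (u y)) x
            + grad (\<lambda>y. p (\<rho> y)) x = 0)"

definition nonhomogeneous_incompressible_Euler ::
    "(real^'n::finite \<Rightarrow> real) \<Rightarrow> (real^'n \<Rightarrow> real^'n) \<Rightarrow> (real^'n \<Rightarrow> real) \<Rightarrow> bool" where
  "nonhomogeneous_incompressible_Euler \<rho> u q \<longleftrightarrow>
     C_class 1 \<rho> \<and> C_class 1 u \<and> C_class 1 q \<and>
     (\<forall>x. divergence u x = 0) \<and>
     (\<forall>x. divergence (\<lambda>y. \<rho> y *\<^sub>R u y) x = 0) \<and>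
     (\<forall>x. \<rho> x *\<^sub>R convective u u x = - grad q x)"

end

theory Submission
  imports Defs
begin

text \<open>Since \<open>U \<cdot> \<nabla>P = 0\<close>, every function of \<open>P\<close> is constant along the flow of \<open>U\<close>, so multiplying
  \<open>U\<close> by such a function preserves incompressibility and merely rescales \<open>U \<cdot> \<nabla>U\<close>; the weight \<open>\<Psi>\<close> is
  chosen such that the rescaled convective term balances the pressure gradient. The analytic point is
  that \<open>\<Psi>\<close> is \<open>C\<^sup>1\<close> where the derivative of \<open>rho_t\<close> vanishes: this derivative is a nonnegative \<open>C\<^sup>2\<close>
  function whose second derivative vanishes at its zeros, and the square root of such a function is
  \<open>C\<^sup>1\<close> by the inequality \<open>g'\<^sup>2 \<le> 2 g sup |g''|\<close>.\<close>

section \<open>Second-order Taylor bounds and square roots of nonnegative functions on the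
  line\<close>

lemma taylor_second_order:
  fixes g :: "real \<Rightarrow> real"
  assumes g: "\<And>x. (g has_real_derivative g1 x) (at x)"
    and g1: "\<And>x. (g1 has_real_derivative g2 x) (at x)"
  obtains t where "\<bar>t - c\<bar> \<le> \<bar>x - c\<bar>" "g x = g c + g1 c * (x - c) + g2 t / 2 * (x - c)\<^sup>2"
proof (cases "x = c")
  case True
  then show ?thesis using that[of c] by simp
next
  case False
  \<comment> \<open>\<open>Taylor\<close> takes the derivatives as one sequence indexed by order, so
    \<open>g\<close>, \<open>g1\<close>, \<open>g2\<close> are packed into \<open>d\<close>. It
    excludes \<open>x = c\<close>, hence the case split.\<close>
  define d where "d m = (if m = 0 then g else if m = 1 then g1 else g2)" for m :: nat
  have "\<exists>t. (if x < c then x < t \<and> t < c else c < t \<and> t < x) \<and>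
      g x = (\<Sum>m<2. (d m c / fact m) * (x - c)^m) + (d 2 t / fact 2) * (x - c)^2"
    by (rule Taylor[where a = "min x c" and b = "max x c"]) (use False g g1 in \<open>auto simp: d_def less_2_cases_iff\<close>)
  then obtain t where "if x < c then x < t \<and> t < c else c < t \<and> t < x"
      "g x = (\<Sum>m<2. (d m c / fact m) * (x - c)^m) + (d 2 t / fact 2) * (x - c)^2" by blast
  then show ?thesis
    by (intro that[of t]) (auto simp: d_def numeral_2_eq_2 split: if_splits)
qed

lemma deriv_zero_of_nonneg:
  fixes g :: "real \<Rightarrow> real"
  assumes "(g has_real_derivative l) (at x)" "\<And>y. 0 \<le> g y" "g x = 0"
  shows "l = 0"
  using DERIV_local_min[OF assms(1), of 1] assms by simp

text \<open>Near \<open>x0\<close> continuity keeps \<open>g2\<close> below \<open>e\<close> in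
  modulus. Expanding at \<open>x0\<close>, where \<open>g\<close> and \<open>g1\<close> vanish,
  gives the first bound; expanding at \<open>x\<close> and using nonnegativity gives the second. The
  first yields differentiability of the square root of \<open>g\<close> at \<open>x0\<close>, the
  second continuity of its derivative there.\<close>

lemma nonneg_flat_zero_bounds:
  fixes g :: "real \<Rightarrow> real"
  assumes g: "\<And>x. (g has_real_derivative g1 x) (at x)"
    and g1: "\<And>x. (g1 has_real_derivative g2 x) (at x)"
    and cont: "continuous_on UNIV g2"
    and nonneg: "\<And>x. 0 \<le> g x"
    and x0: "g x0 = 0" "g2 x0 = 0"
    and e: "e > 0"
  obtains d where "d > 0"
    "\<And>x. \<bar>x - x0\<bar> < d \<Longrightarrow> g x \<le> e * (x - x0)\<^sup>2"
    "\<And>x. \<bar>x - x0\<bar> < d \<Longrightarrow> (g1 x)\<^sup>2 \<le> 2 * e * g x"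
proof -
  have "isCont g2 x0" using cont by (simp add: continuous_on_eq_continuous_at)
  then obtain D where D: "D > 0" "\<And>x. \<bar>x - x0\<bar> < D \<Longrightarrow> \<bar>g2 x\<bar> < e"
    using e x0(2) by (auto simp: continuous_at_eps_delta dist_real_def)
  have g10: "g1 x0 = 0" using deriv_zero_of_nonneg g nonneg x0 by blast
  show ?thesis
  \<comment> \<open>Half the radius leaves room for a second step from \<open>x\<close>, as long as
    the distance to \<open>x0\<close>, without leaving the region where \<open>g2\<close> is
    small.\<close>
  proof (rule that[of "D / 2"])
    fix x assume x: "\<bar>x - x0\<bar> < D / 2"
    obtain t where t: "\<bar>t - x0\<bar> \<le> \<bar>x - x0\<bar>" "g x = g x0 + g1 x0 * (x - x0) + g2 t / 2 * (x - x0)\<^sup>2"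
      using taylor_second_order[of g g1 g2] g g1 by blast
    have "\<bar>g2 t\<bar> < e" using D t x by auto
    then have "g2 t / 2 \<le> e" using e by linarith
    then have "g2 t / 2 * (x - x0)\<^sup>2 \<le> e * (x - x0)\<^sup>2" by (rule mult_right_mono) simp
    then show "g x \<le> e * (x - x0)\<^sup>2"
      using t(2) x0 g10 by simp
    \<comment> \<open>The mean value bound is what keeps the step \<open>h\<close> below no longer
      than the distance from \<open>x\<close> to \<open>x0\<close>.\<close>
    have g1x: "\<bar>g1 x\<bar> \<le> e * \<bar>x - x0\<bar>"
    proof -
      have "norm (g1 x - g1 x0) \<le> e * norm (x - x0)"
      proof (rule field_differentiable_bound[where S = "ball x0 (D / 2)"])
        show "norm (g2 z) \<le> e" if "z \<in> ball x0 (D / 2)" for z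
          using D(2)[of z] D(1) that by (simp add: dist_real_def abs_minus_commute)
      qed (use x D(1) g1 in \<open>auto simp: dist_real_def abs_minus_commute intro: has_field_derivative_at_within\<close>)
      then show ?thesis using g10 by simp
    qed
    text \<open>The nonnegativity of the Taylor expansion at the point minimising the quadratic upper bound.\<close>
    define h where "h = - g1 x / e"
    obtain t where t: "\<bar>t - x\<bar> \<le> \<bar>(x + h) - x\<bar>"
        "g (x + h) = g x + g1 x * ((x + h) - x) + g2 t / 2 * ((x + h) - x)\<^sup>2"
      using taylor_second_order[of g g1 g2] g g1 by blast
    have "\<bar>h\<bar> \<le> \<bar>x - x0\<bar>"
      using g1x e by (simp add: h_def divide_le_eq mult.commute)
    then have "\<bar>t - x0\<bar> < D" using t(1) x by linarith
    then have "g2 t \<le> e" using D(2)[of t] by linarith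
    then have "g2 t / 2 * h\<^sup>2 \<le> e / 2 * h\<^sup>2" by (intro mult_right_mono) auto
    then have "0 \<le> g x + g1 x * h + e / 2 * h\<^sup>2" using t(2) nonneg[of "x + h"] by simp
    also have "\<dots> = g x - (g1 x)\<^sup>2 / (2 * e)" using e by (simp add: h_def field_simps power2_eq_square)
    finally show "(g1 x)\<^sup>2 \<le> 2 * e * g x" using e by (simp add: field_simps)
  qed (use D in auto)
qed

text \<open>At zeros of \<open>g\<close> the quotient in the following two lemmas is \<open>x / 0 = 0\<close>, the correct value.\<close>

lemma has_real_derivative_sqrt_nonneg:
  fixes g :: "real \<Rightarrow> real"
  assumes g: "\<And>x. (g has_real_derivative g1 x) (at x)"
    and g1: "\<And>x. (g1 has_real_derivative g2 x) (at x)"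
    and cont: "continuous_on UNIV g2"
    and nonneg: "\<And>x. 0 \<le> g x"
    and zero: "\<And>x. g x = 0 \<Longrightarrow> g2 x = 0"
  shows "((\<lambda>x. sqrt (g x)) has_real_derivative g1 x / (2 * sqrt (g x))) (at x)"
proof (cases "g x = 0")
  case False
  then have "g x > 0" using nonneg[of x] by simp
  then show ?thesis
    by (auto intro!: derivative_eq_intros g simp: field_simps)
next
  case True
  have "(\<lambda>h. (sqrt (g (x + h)) - sqrt (g x)) / h) \<midarrow>0\<rightarrow> 0"
  proof (rule LIM_I)
    fix r :: real assume r: "0 < r"
    \<comment> \<open>The constant is a square so that taking roots bounds the difference quotient
      by \<open>r / 2\<close>, which is strictly below \<open>r\<close>.\<close>
    obtain d where d: "d > 0" "\<And>y. \<bar>y - x\<bar> < d \<Longrightarrow> g y \<le> (r / 2)\<^sup>2 * (y - x)\<^sup>2"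
      using nonneg_flat_zero_bounds[OF g g1 cont nonneg True zero[OF True], of "(r / 2)\<^sup>2"] r
      by (metis half_gt_zero zero_less_power)
    have "norm ((sqrt (g (x + h)) - sqrt (g x)) / h - 0) < r" if h: "h \<noteq> 0" "\<bar>h\<bar> < d" for h
    proof -
      have "g (x + h) \<le> (r / 2 * \<bar>h\<bar>)\<^sup>2" using d(2)[of "x + h"] h by (simp add: power_mult_distrib power_divide)
      then have "sqrt (g (x + h)) \<le> r / 2 * \<bar>h\<bar>"
        using r by (intro real_le_lsqrt) auto
      then have "\<bar>sqrt (g (x + h)) / h\<bar> \<le> r / 2" using h nonneg by (simp add: abs_divide divide_le_eq)
      then have "\<bar>sqrt (g (x + h)) / h\<bar> < r" using r by linarith
      then show ?thesis using True by simp
    qed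
    then show "\<exists>s>0. \<forall>h. h \<noteq> 0 \<and> norm (h - 0) < s \<longrightarrow> norm ((sqrt (g (x + h)) - sqrt (g x)) / h - 0) < r"
      using d(1) by (auto intro!: exI[of _ d])
  qed
  then show ?thesis using True by (simp add: DERIV_def)
qed

lemma continuous_on_deriv_sqrt_nonneg:
  fixes g :: "real \<Rightarrow> real"
  assumes g: "\<And>x. (g has_real_derivative g1 x) (at x)"
    and g1: "\<And>x. (g1 has_real_derivative g2 x) (at x)"
    and cont: "continuous_on UNIV g2"
    and nonneg: "\<And>x. 0 \<le> g x"
    and zero: "\<And>x. g x = 0 \<Longrightarrow> g2 x = 0"
  shows "continuous_on UNIV (\<lambda>x. g1 x / (2 * sqrt (g x)))"
proof -
  have "isCont (\<lambda>x. g1 x / (2 * sqrt (g x))) x" for x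
  proof (cases "g x = 0")
    case False
    then show ?thesis
      using DERIV_isCont[OF g, of x] DERIV_isCont[OF g1, of x]
      by (auto intro!: isCont_divide continuous_real_sqrt isCont_mult)
  next
    case True
    show ?thesis
      unfolding continuous_at_eps_delta
    proof (intro allI impI)
      fix r :: real assume r: "r > 0"
      \<comment> \<open>This constant gives \<open>(g1 y)\<^sup>2 \<le> r\<^sup>2 * g y\<close>, so
        the quotient is at most \<open>r / 2\<close>.\<close>
      obtain d where d: "d > 0" "\<And>y. \<bar>y - x\<bar> < d \<Longrightarrow> (g1 y)\<^sup>2 \<le> 2 * (r / 2)\<^sup>2 * g y"
        using nonneg_flat_zero_bounds[OF g g1 cont nonneg True zero[OF True], of "(r / 2)\<^sup>2"] r
        by (metis half_gt_zero zero_less_power)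
      have "dist (g1 y / (2 * sqrt (g y))) (g1 x / (2 * sqrt (g x))) < r" if y: "\<bar>y - x\<bar> < d" for y
      \<comment> \<open>Further zeros of \<open>g\<close> may lie arbitrarily close to
        \<open>x\<close>; at those the quotient is 0, as at \<open>x\<close>.\<close>
      proof (cases "g y = 0")
        case gy: False
        have "(g1 y)\<^sup>2 \<le> 2 * (r / 2)\<^sup>2 * g y" using d(2) y by blast
        also have "\<dots> \<le> r\<^sup>2 * g y"
          using nonneg[of y] by (intro mult_right_mono) (simp_all add: power_divide)
        also have "\<dots> = (r * sqrt (g y))\<^sup>2" using nonneg[of y] by (simp add: power_mult_distrib)
        finally have "\<bar>g1 y\<bar> \<le> r * sqrt (g y)"
          using r nonneg[of y] abs_le_square_iff[of "g1 y" "r * sqrt (g y)"] by (simp add: abs_mult)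
        moreover have s: "sqrt (g y) > 0" using gy nonneg[of y] by simp
        ultimately have "\<bar>g1 y\<bar> / (2 * sqrt (g y)) < r"
          using mult_pos_pos[OF r s] by (simp add: pos_divide_less_eq)
        then have "\<bar>g1 y / (2 * sqrt (g y))\<bar> < r" using s by (simp add: abs_divide)
        then show ?thesis using True r by (simp add: dist_real_def)
      qed (use True r in auto)
      then show "\<exists>d>0. \<forall>y. dist y x < d \<longrightarrow> dist (g1 y / (2 * sqrt (g y))) (g1 x / (2 * sqrt (g x))) < r"
        using d(1) by (auto simp: dist_real_def)
    qed
  qed
  then show ?thesis by (simp add: continuous_on_eq_continuous_at)
qed

text \<open>On the open set \<open>f\<close> is locally constant, and the zero set of the continuous
  \<open>f'\<close> is closed. This carries the vanishing of derivatives to the endpoints of the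
  intervals where the density profile is constant.\<close>

lemma deriv_zero_on_closure:
  fixes f f' :: "real \<Rightarrow> real"
  assumes "open S" "\<And>x. x \<in> S \<Longrightarrow> f x = c"
    and f: "\<And>x. (f has_real_derivative f' x) (at x)" and "continuous_on UNIV f'"
    and "x \<in> closure S"
  shows "f' x = 0"
proof -
  have "f' y = 0" if y: "y \<in> S" for y
  proof -
    have "((\<lambda>x. c) has_real_derivative f' y) (at y)"
      by (rule has_field_derivative_transform_within_open[OF f \<open>open S\<close> y]) (rule assms(2))
    then show ?thesis by (rule DERIV_unique) (rule DERIV_const)
  qed
  then have "S \<subseteq> f' -` {0}" by auto
  moreover have "closed (f' -` {0})"
    using assms(4) by (intro continuous_closed_vimage) (auto simp: continuous_on_eq_continuous_at)
  ultimately show ?thesis using closure_minimal assms(5) by blast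
qed

section \<open>Class \<open>C_class 1\<close>: functions on the line, compositions and
  products\<close>

lemma C_class_1_iff:
  "C_class 1 f \<longleftrightarrow> (\<forall>x. f differentiable (at x)) \<and>
     (\<forall>v. continuous_on UNIV (\<lambda>x. frechet_derivative f (at x) v))"
  unfolding One_nat_def C_class.simps ..

text \<open>On the line the directional derivative in direction 1 is the ordinary one, which turns
  the recursion of \<open>C_class\<close> into iteration of \<open>deriv\<close>.\<close>

lemma C_class_Suc_real:
  fixes f :: "real \<Rightarrow> real"
  assumes "C_class (Suc k) f"
  shows "(f has_real_derivative deriv f x) (at x)" and "C_class k (deriv f)"
proof -
  show D: "(f has_real_derivative deriv f x) (at x)" for x
    using assms by (simp add: DERIV_deriv_iff_real_differentiable)
  have "frechet_derivative f (at x) 1 = deriv f x" for x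
    using fun_cong[OF frechet_derivative_at[OF D[of x, unfolded has_field_derivative_def]], of 1] by simp
  then have "(\<lambda>x. frechet_derivative f (at x) 1) = deriv f" by (rule ext)
  moreover have "C_class k (\<lambda>x. frechet_derivative f (at x) 1)" using assms by simp
  ultimately show "C_class k (deriv f)" by simp
qed

lemma C_class_1_realI:
  fixes f :: "real \<Rightarrow> real"
  assumes f: "\<And>x. (f has_real_derivative f' x) (at x)" and "continuous_on UNIV f'"
  shows "C_class 1 f"
proof -
  have "frechet_derivative f (at x) v = f' x * v" for x v
    using fun_cong[OF frechet_derivative_at[OF f[of x, unfolded has_field_derivative_def]], of v] by simp
  moreover have "f differentiable (at x)" for x
    using f real_differentiable_def by blast
  ultimately show ?thesis
    unfolding C_class_1_iff using assms(2) by (auto intro!: continuous_intros)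
qed

lemma C_class_1_continuous_on:
  assumes "C_class 1 f"
  shows "continuous_on UNIV f"
  using assms by (auto simp: continuous_on_eq_continuous_at differentiable_imp_continuous_within)

lemma frechet_derivative_real_compose:
  fixes h :: "real \<Rightarrow> real"
  assumes "C_class 1 h" "P differentiable (at x)"
  shows "((\<lambda>y. h (P y)) has_derivative (\<lambda>v. deriv h (P x) * frechet_derivative P (at x) v)) (at x)"
  using has_derivative_compose[OF assms(2)[unfolded frechet_derivative_works]
      C_class_Suc_real(1)[of 0 h, unfolded has_field_derivative_def]] assms(1) by simp

lemma C_class_1_real_compose:
  fixes h :: "real \<Rightarrow> real"
  assumes "C_class 1 h" "C_class 1 P"
  shows "C_class 1 (\<lambda>x. h (P x))"
proof -
  have P: "P differentiable (at x)" for x using assms by simp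
  have "continuous_on UNIV (deriv h)" using C_class_Suc_real(2)[of 0 h] assms by simp
  then have "continuous_on UNIV (\<lambda>x. deriv h (P x))"
    using C_class_1_continuous_on[OF assms(2)] by (metis continuous_on_compose2 subset_UNIV)
  moreover have "frechet_derivative (\<lambda>x. h (P x)) (at x) = (\<lambda>v. deriv h (P x) * frechet_derivative P (at x) v)" for x
    using frechet_derivative_at[OF frechet_derivative_real_compose[OF assms(1) P]] by simp
  moreover have "(\<lambda>x. h (P x)) differentiable (at x)" for x
    using frechet_derivative_real_compose[OF assms(1) P] differentiableI by blast
  ultimately show ?thesis
    unfolding C_class_1_iff using assms(2) by (auto intro!: continuous_intros)
qed

lemma has_derivative_scaleR_frechet:
  assumes "f differentiable (at x)" "V differentiable (at x)"
  shows "((\<lambda>y. f y *\<^sub>R V y) has_derivative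
    (\<lambda>v. f x *\<^sub>R frechet_derivative V (at x) v + frechet_derivative f (at x) v *\<^sub>R V x)) (at x)"
  using assms unfolding frechet_derivative_works by (rule has_derivative_scaleR)

lemma C_class_1_scaleR:
  assumes "C_class 1 f" "C_class 1 V"
  shows "C_class 1 (\<lambda>x. f x *\<^sub>R V x)"
proof -
  have d: "f differentiable (at x)" "V differentiable (at x)" for x using assms by auto
  have "frechet_derivative (\<lambda>x. f x *\<^sub>R V x) (at x) =
      (\<lambda>v. f x *\<^sub>R frechet_derivative V (at x) v + frechet_derivative f (at x) v *\<^sub>R V x)" for x
    using frechet_derivative_at[OF has_derivative_scaleR_frechet[OF d]] by simp
  moreover have "(\<lambda>x. f x *\<^sub>R V x) differentiable (at x)" for x
    using has_derivative_scaleR_frechet[OF d] differentiableI by blast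
  ultimately show ?thesis
    unfolding C_class_1_iff using assms C_class_1_continuous_on[OF assms(1)] C_class_1_continuous_on[OF assms(2)]
    by (auto intro!: continuous_intros)
qed

section \<open>Product and chain rules for the differential operators\<close>

lemma partial_scaleR:
  assumes "f differentiable (at x)" "V differentiable (at x)"
  shows "partial j (\<lambda>y. f y *\<^sub>R V y) x = f x *\<^sub>R partial j V x + partial j f x *\<^sub>R V x"
  unfolding partial_def frechet_derivative_at[OF has_derivative_scaleR_frechet[OF assms], symmetric] ..

lemma partial_real_compose:
  fixes h :: "real \<Rightarrow> real"
  assumes "C_class 1 h" "P differentiable (at x)"
  shows "partial j (\<lambda>y. h (P y)) x = deriv h (P x) * partial j P x"
  unfolding partial_def frechet_derivative_at[OF frechet_derivative_real_compose[OF assms], symmetric] ..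

lemma has_derivative_vec_nth_frechet:
  fixes V :: "real^'n::finite \<Rightarrow> real^'m::finite"
  assumes "V differentiable (at x)"
  shows "((\<lambda>y. V y $ i) has_derivative (\<lambda>v. frechet_derivative V (at x) v $ i)) (at x)"
  using assms unfolding frechet_derivative_works
  by (rule bounded_linear.has_derivative[OF bounded_linear_vec_nth])

lemma partial_vec_nth:
  fixes V :: "real^'n::finite \<Rightarrow> real^'m::finite"
  assumes "V differentiable (at x)"
  shows "partial j (\<lambda>y. V y $ i) x = partial j V x $ i"
  unfolding partial_def frechet_derivative_at[OF has_derivative_vec_nth_frechet[OF assms], symmetric] ..

lemma differentiable_vec_nth:
  fixes V :: "real^'n::finite \<Rightarrow> real^'m::finite"
  assumes "V differentiable (at x)"
  shows "(\<lambda>y. V y $ i) differentiable (at x)"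
  using has_derivative_vec_nth_frechet[OF assms] differentiableI by blast

lemma convective_scaleR_left:
  "convective (\<lambda>y. f y *\<^sub>R V y) W x = f x *\<^sub>R convective V W x"
  by (simp add: convective_def scaleR_sum_right)

lemma convective_scaleR_right:
  assumes "f differentiable (at x)" "W differentiable (at x)"
  shows "convective V (\<lambda>y. f y *\<^sub>R W y) x = convective V f x *\<^sub>R W x + f x *\<^sub>R convective V W x"
  by (simp add: convective_def partial_scaleR[OF assms] scaleR_sum_right scaleR_sum_left
      sum.distrib[symmetric] algebra_simps)

lemma convective_real_compose:
  fixes h :: "real \<Rightarrow> real"
  assumes "C_class 1 h" "P differentiable (at x)"
  shows "convective V (\<lambda>y. h (P y)) x = deriv h (P x) * convective V P x"
  by (simp add: convective_def partial_real_compose[OF assms] sum_distrib_left mult_ac)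

lemma grad_real_compose:
  fixes h :: "real \<Rightarrow> real"
  assumes "C_class 1 h" "P differentiable (at x)"
  shows "grad (\<lambda>y. h (P y)) x = deriv h (P x) *\<^sub>R grad P x"
  by (simp add: grad_def partial_real_compose[OF assms] vec_eq_iff)

lemma divergence_scaleR:
  assumes "f differentiable (at x)" "V differentiable (at x)"
  shows "divergence (\<lambda>y. f y *\<^sub>R V y) x = convective V f x + f x * divergence V x"
proof -
  have "partial j (\<lambda>y. f y * V y $ j) x = f x * partial j (\<lambda>y. V y $ j) x + partial j f x * V x $ j" for j
    using partial_scaleR[OF assms(1) differentiable_vec_nth[OF assms(2)]] by simp
  then show ?thesis
    by (simp add: divergence_def convective_def sum.distrib sum_distrib_left mult_ac add.commute)
qed

text \<open>The summation index belongs to the second factor, so \<open>W\<close> carries the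
  divergence and also does the convecting.\<close>

lemma tensor_divergence_tensor_product:
  assumes "V differentiable (at x)" "W differentiable (at x)"
  shows "tensor_divergence (\<lambda>y. tensor_product (V y) (W y)) x
    = divergence W x *\<^sub>R V x + convective W V x"
proof -
  have "partial j (\<lambda>y. V y $ i * W y $ j) x = V x $ i * partial j (\<lambda>y. W y $ j) x + partial j V x $ i * W x $ j" for i j
    using partial_scaleR[OF differentiable_vec_nth[OF assms(1)] differentiable_vec_nth[OF assms(2)]]
    by (simp add: partial_vec_nth[OF assms(1)])
  then show ?thesis
    by (simp add: tensor_divergence_def tensor_product_def divergence_def convective_def vec_eq_iff
        sum.distrib sum_distrib_left sum_distrib_right mult_ac)
qed

text \<open>The density is moved into the second tensor factor. The product rule then produces the
  divergence of the mass flux, which is zero, and leaves only the convective term.\<close>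

lemma isentropic_Euler_iff:
  fixes u :: "real^'n::finite \<Rightarrow> real^'n"
  assumes "C_class 1 \<rho>" "C_class 1 u" "\<And>x. divergence (\<lambda>y. \<rho> y *\<^sub>R u y) x = 0"
  shows "isentropic_Euler p \<rho> u \<longleftrightarrow> (\<forall>x. \<rho> x *\<^sub>R convective u u x = - grad (\<lambda>y. p (\<rho> y)) x)"
proof -
  have "\<rho> y *\<^sub>R tensor_product (u y) (u y) = tensor_product (u y) (\<rho> y *\<^sub>R u y)" for y
    by (simp add: tensor_product_def vec_eq_iff mult_ac)
  moreover have "u differentiable (at x)" "(\<lambda>y. \<rho> y *\<^sub>R u y) differentiable (at x)" for x
    using assms(2) C_class_1_scaleR[OF assms(1,2)] by auto
  ultimately have "tensor_divergence (\<lambda>y. \<rho> y *\<^sub>R tensor_product (u y) (u y)) x = \<rho> x *\<^sub>R convective u u x" for x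
    using assms(3) by (simp add: tensor_divergence_tensor_product convective_scaleR_left)
  then show ?thesis
    using assms by (simp add: isentropic_Euler_def eq_neg_iff_add_eq_0)
qed

section \<open>Functions whose gradient vanishes outside a ball\<close>

lemma grad_zero_imp_has_derivative_zero:
  fixes P :: "real^'n::finite \<Rightarrow> real"
  assumes "P differentiable (at x)" "grad P x = 0"
  shows "(P has_derivative (\<lambda>v. 0)) (at x)"
proof -
  have D: "(P has_derivative frechet_derivative P (at x)) (at x)"
    using assms(1) by (simp add: frechet_derivative_works)
  have "frechet_derivative P (at x) = (\<lambda>v. 0)"
  proof (rule linear_eq_stdbasis)
    fix w :: "real^'n" assume "w \<in> Basis"
    then obtain i where "w = axis i 1" using axis_inverse by blast
    then show "frechet_derivative P (at x) w = 0"
      using arg_cong[OF assms(2), of "\<lambda>w. w $ i"] by (simp add: grad_def partial_def)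
  qed (use D has_derivative_linear in \<open>auto intro: linear_zero\<close>)
  then show ?thesis using D by simp
qed

text \<open>In dimension at least two the complement of a closed ball is open and connected, so a
  zero derivative there forces a single constant value.\<close>

lemma grad_zero_outside_ball_imp_constant:
  fixes P :: "real^'n::finite \<Rightarrow> real"
  assumes "2 \<le> CARD('n)" "\<And>x. P differentiable (at x)" "\<And>x. r < norm x \<Longrightarrow> grad P x = 0"
  obtains c where "\<And>x. r < norm x \<Longrightarrow> P x = c"
proof (cases "\<exists>x::real^'n. r < norm x")
  case True
  then obtain x0 :: "real^'n" where x0: "r < norm x0" by blast
  have "P x = P x0" if "r < norm x" for x
    by (rule has_derivative_zero_unique_connected[of "- cball 0 r"])
      (use that x0 assms in \<open>auto intro!: connected_complement_bounded_convex grad_zero_imp_has_derivative_zero\<close>)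
  then show ?thesis using that by blast
qed (use that in blast)

theorem mainTheorem2:
  fixes \<gamma> a rho_inf s_inf P_inf b rho_0 :: real
    and U :: "real^3 \<Rightarrow> real^3" and P :: "real^3 \<Rightarrow> real"
    and rho_t \<Psi> :: "real \<Rightarrow> real"
    and \<rho> :: "real^3 \<Rightarrow> real" and u :: "real^3 \<Rightarrow> real^3"
  assumes "\<gamma> > 1" and "a > 0" and "rho_inf > 0"
    and "smooth U" and "smooth P"
    and "\<And>x. convective U U x + grad P x = 0"
    and "\<And>x. divergence U x = 0"
    and "\<And>x. convective U P x = 0"
    and "compact (closure {x. U x \<noteq> 0})"
    and "P_inf = Lim at_infinity P"
    and "b \<le> (INF x. P x)" and "b < P_inf" and "rho_0 > 0"
    and "C_class 3 rho_t"
    and "\<And>z. z \<le> b \<Longrightarrow> rho_t z = rho_0"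
    and "\<And>z. z \<ge> P_inf \<Longrightarrow> rho_t z = rho_inf"
    and "\<And>z. z \<in> {b<..<P_inf} \<Longrightarrow> deriv rho_t z > 0"
    and "\<Psi> = (\<lambda>z. sqrt (1 / rho_t z * deriv (\<lambda>y. pressure \<gamma> a (rho_t y) s_inf) z))"
    and "\<rho> = (\<lambda>x. rho_t (P x))"
    and "u = (\<lambda>x. \<Psi> (P x) *\<^sub>R U x)"
  shows "isentropic_Euler (\<lambda>r. pressure \<gamma> a r s_inf) \<rho> u
    \<and> (u \<longlongrightarrow> 0) at_infinity \<and> (\<rho> \<longlongrightarrow> rho_inf) at_infinity
    \<and> (\<forall>x. divergence u x = 0) \<and> (\<forall>x. convective u \<rho> x = 0)
    \<and> (\<exists>q. nonhomogeneous_incompressible_Euler \<rho> u q)"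
proof -
  note gamma = \<open>\<gamma> > 1\<close> and C3 = \<open>C_class 3 rho_t\<close> and bP = \<open>b < P_inf\<close>
    and low = \<open>\<And>z. z \<le> b \<Longrightarrow> rho_t z = rho_0\<close> and high = \<open>\<And>z. z \<ge> P_inf \<Longrightarrow> rho_t z = rho_inf\<close>
    and rho_eq = \<open>\<rho> = (\<lambda>x. rho_t (P x))\<close> and u_eq = \<open>u = (\<lambda>x. \<Psi> (P x) *\<^sub>R U x)\<close>
    and euler = \<open>\<And>x. convective U U x + grad P x = 0\<close> and UP = \<open>\<And>x. convective U P x = 0\<close>
    and divU = \<open>\<And>x. divergence U x = 0\<close>

  \<comment> \<open>Derivatives and positivity of the density profile\<close>
  define g where "g = deriv rho_t"
  define g1 where "g1 = deriv g"
  define g2 where "g2 = deriv g1"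
  have r_g: "(rho_t has_real_derivative g z) (at z)" and "C_class 2 g" for z
    using C_class_Suc_real[of 2 rho_t] C3 by (simp_all add: g_def)
  then have g_g1: "(g has_real_derivative g1 z) (at z)" and "C_class 1 g1" for z
    using C_class_Suc_real[of 1 g] by (simp_all add: g1_def numeral_2_eq_2)
  then have g1_g2: "(g1 has_real_derivative g2 z) (at z)" and g2_cont: "continuous_on UNIV g2" for z
    using C_class_Suc_real[of 0 g1] by (simp_all add: g2_def)
  have r_cont: "continuous_on UNIV rho_t" and g_cont: "continuous_on UNIV g" and g1_cont: "continuous_on UNIV g1"
    using r_g g_g1 g1_g2 by (auto intro!: DERIV_continuous_on)

  \<comment> \<open>Three passes of \<open>deriv_zero_on_closure\<close>, for \<open>rho_t\<close>,
    \<open>g\<close> and \<open>g1\<close>, use the three continuous derivatives of the profile.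
    Closures are taken in order to reach \<open>b\<close> and \<open>P_inf\<close>
    themselves.\<close>
  have flat: "g z = 0 \<and> g2 z = 0" if z: "z \<in> closure S" and S: "S = {..<b} \<or> S = {P_inf<..}" for S z
  proof -
    have "open S" using S by auto
    have "\<exists>c. \<forall>y\<in>S. rho_t y = c" using S low high by (metis greaterThan_iff lessThan_iff less_imp_le)
    then obtain c where c: "\<And>y. y \<in> S \<Longrightarrow> rho_t y = c" by blast
    have g0: "g y = 0" if "y \<in> closure S" for y
      using deriv_zero_on_closure[OF \<open>open S\<close> _ r_g g_cont that] c by blast
    have g10: "g1 y = 0" if "y \<in> closure S" for y
      using deriv_zero_on_closure[OF \<open>open S\<close> _ g_g1 g1_cont that] g0 closure_subset by blast
    have g20: "g2 y = 0" if "y \<in> closure S" for y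
      using deriv_zero_on_closure[OF \<open>open S\<close> _ g1_g2 g2_cont that] g10 closure_subset by blast
    show ?thesis using g0 g20 z by blast
  qed
  \<comment> \<open>This supplies both conditions of the square root lemmas: \<open>g\<close> is
    nonnegative, and \<open>g2\<close> vanishes wherever \<open>g\<close> does.\<close>
  have g_cases: "g z > 0 \<or> (g z = 0 \<and> g2 z = 0)" for z
  proof (cases "z \<in> {b<..<P_inf}")
    case False
    then have "z \<in> closure {..<b} \<or> z \<in> closure {P_inf<..}" by auto
    then show ?thesis using flat by blast
  qed (use \<open>\<And>z. z \<in> {b<..<P_inf} \<Longrightarrow> deriv rho_t z > 0\<close> g_def in blast)
  then have g_nonneg: "g z \<ge> 0" and g2_zero: "g z = 0 \<Longrightarrow> g2 z = 0" for z
    using less_le_not_le[of 0 "g z"] by (metis order.refl, metis less_irrefl)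
  \<comment> \<open>The profile is nondecreasing and starts from \<open>rho_0\<close> at
    \<open>b\<close>. Positivity makes its real powers differentiable, also for negative
    exponents.\<close>
  have r_pos: "rho_t z > 0" for z
  proof (cases "z \<le> b")
    case False
    then have "rho_t b \<le> rho_t z"
      using r_g g_nonneg by (intro deriv_nonneg_imp_mono[of b z rho_t g]) auto
    then show ?thesis using low[of b] \<open>rho_0 > 0\<close> by simp
  qed (use low \<open>rho_0 > 0\<close> in simp)

  \<comment> \<open>The pressure along the profile and the regularity of the weight
    \<open>\<Psi>\<close>\<close>
  define p where "p z = pressure \<gamma> a (rho_t z) s_inf" for z
  define p' where "p' z = \<gamma> * rho_t z powr (\<gamma> - 1) * g z * exp (a * s_inf)" for z
  have p_p': "(p has_real_derivative p' z) (at z)" for z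
    unfolding p_def p'_def pressure_def
    using DERIV_cmult_right[OF DERIV_fun_powr[OF r_g r_pos, of \<gamma> z], of "exp (a * s_inf)"] by simp
  have p'_cont: "continuous_on UNIV p'"
    unfolding p'_def using r_cont g_cont r_pos by (intro continuous_intros) (auto simp: less_imp_neq[symmetric])
  have p_C1: "C_class 1 p" using C_class_1_realI[OF p_p' p'_cont] .
  have p_deriv: "deriv p z = p' z" for z using DERIV_imp_deriv[OF p_p'] .

  \<comment> \<open>The square of \<open>\<Psi>\<close> is \<open>\<gamma> * exp (a * s_inf) * rho_t
    z powr (\<gamma> - 2) * g z\<close>. Splitting off \<open>k\<close>, which is harmless because
    \<open>rho_t\<close> is positive, leaves \<open>sqrt (g z)\<close> as the only degenerate
    factor.\<close>
  define k where "k z = sqrt (\<gamma> * exp (a * s_inf)) * rho_t z powr ((\<gamma> - 2) / 2)" for z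
  define k' where "k' z = sqrt (\<gamma> * exp (a * s_inf)) * ((\<gamma> - 2) / 2 * rho_t z powr ((\<gamma> - 2) / 2 - 1) * g z)" for z
  have Psi_p': "\<Psi> z = sqrt (p' z / rho_t z)" for z
  proof -
    have "(\<lambda>y. pressure \<gamma> a (rho_t y) s_inf) = p" by (simp add: p_def fun_eq_iff)
    then show ?thesis using p_deriv \<open>\<Psi> = _\<close> by simp
  qed
  \<comment> \<open>This identity is the reason for the choice of \<open>\<Psi>\<close>: it turns
    the weight in the momentum equation into the derivative of the pressure.\<close>
  have Psi_sq: "rho_t z * (\<Psi> z)\<^sup>2 = p' z" for z
  proof -
    have "p' z \<ge> 0" unfolding p'_def using g_nonneg gamma by simp
    then show ?thesis using r_pos[of z] by (simp add: Psi_p')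
  qed
  have Psi_k: "\<Psi> z = k z * sqrt (g z)" for z
  proof -
    have "p' z / rho_t z = \<gamma> * exp (a * s_inf) * (rho_t z powr ((\<gamma> - 2) / 2))\<^sup>2 * g z"
    proof -
      have "(rho_t z powr ((\<gamma> - 2) / 2))\<^sup>2 = rho_t z powr (\<gamma> - 1 - 1)"
        unfolding power2_eq_square powr_add[symmetric] by simp
      also have "\<dots> = rho_t z powr (\<gamma> - 1) / rho_t z"
        using r_pos[of z] by (simp add: powr_diff power2_eq_square)
      finally show ?thesis by (simp add: p'_def)
    qed
    then show ?thesis
      by (simp add: Psi_p' k_def real_sqrt_mult)
  qed
  have k_k': "(k has_real_derivative k' z) (at z)" for z
    unfolding k_def k'_def
    by (rule DERIV_cmult) (use DERIV_fun_powr[OF r_g r_pos, of "(\<gamma> - 2) / 2" z] in simp)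
  have kk'_cont: "continuous_on UNIV k" "continuous_on UNIV k'"
    unfolding k_def k'_def using r_cont g_cont r_pos
    by (auto intro!: continuous_intros simp: less_imp_neq[symmetric])
  note sq = has_real_derivative_sqrt_nonneg[OF g_g1 g1_g2 g2_cont g_nonneg g2_zero]
  note sq' = continuous_on_deriv_sqrt_nonneg[OF g_g1 g1_g2 g2_cont g_nonneg g2_zero]
  have "C_class 1 k" using C_class_1_realI[OF k_k' kk'_cont(2)] .
  moreover have "C_class 1 (\<lambda>z. sqrt (g z))" using C_class_1_realI[OF sq sq'] .
  moreover have "\<Psi> = (\<lambda>z. k z *\<^sub>R sqrt (g z))" using Psi_k by auto
  ultimately have Psi_C1: "C_class 1 \<Psi>" by (simp only: C_class_1_scaleR)
  have r_C1: "C_class 1 rho_t" using C_class_1_realI[OF r_g g_cont] .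

  \<comment> \<open>Regularity of the composed fields\<close>
  have U_C1: "C_class 1 U" and P_C1: "C_class 1 P"
    using \<open>smooth U\<close> \<open>smooth P\<close> unfolding smooth_def by blast+
  have rho_C1: "C_class 1 \<rho>" unfolding rho_eq using C_class_1_real_compose[OF r_C1 P_C1] .
  have PsiP_C1: "C_class 1 (\<lambda>x. \<Psi> (P x))" using C_class_1_real_compose[OF Psi_C1 P_C1] .
  have u_C1: "C_class 1 u" unfolding u_eq using C_class_1_scaleR[OF PsiP_C1 U_C1] .
  have q_C1: "C_class 1 (\<lambda>x. p (P x))" using C_class_1_real_compose[OF p_C1 P_C1] .
  have dU: "U differentiable (at x)" and dP: "P differentiable (at x)" and drho: "\<rho> differentiable (at x)"
    and dPsi: "(\<lambda>x. \<Psi> (P x)) differentiable (at x)" and du: "u differentiable (at x)" for x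
    using U_C1 P_C1 rho_C1 PsiP_C1 u_C1 unfolding C_class_1_iff by blast+

  \<comment> \<open>Incompressibility, transport and momentum balance\<close>
  have conv_Psi: "convective U (\<lambda>x. \<Psi> (P x)) x = 0" for x
    using convective_real_compose[OF Psi_C1 dP] UP by simp
  have div_u: "divergence u x = 0" for x
    unfolding u_eq using divergence_scaleR[OF dPsi dU] conv_Psi divU by simp
  have conv_rho: "convective u \<rho> x = 0" for x
    unfolding u_eq convective_scaleR_left rho_eq using convective_real_compose[OF r_C1 dP] UP by simp
  have div_rho_u: "divergence (\<lambda>y. \<rho> y *\<^sub>R u y) x = 0" for x
    using divergence_scaleR[OF drho du] conv_rho div_u by simp
  \<comment> \<open>The derivative of \<open>\<Psi>(P)\<close> along \<open>U\<close> drops out by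
    \<open>conv_Psi\<close>, so the convective term is only rescaled by the square of
    \<open>\<Psi>(P)\<close>.\<close>
  have momentum: "\<rho> x *\<^sub>R convective u u x = - grad (\<lambda>y. p (P y)) x" for x
  proof -
    have "convective u u x = \<Psi> (P x) *\<^sub>R (\<Psi> (P x) *\<^sub>R convective U U x)"
      unfolding u_eq convective_scaleR_left convective_scaleR_right[OF dPsi dU] conv_Psi by simp
    also have "convective U U x = - grad P x" using euler[of x] by (simp add: eq_neg_iff_add_eq_0)
    finally have "\<rho> x *\<^sub>R convective u u x = - (rho_t (P x) * (\<Psi> (P x))\<^sup>2) *\<^sub>R grad P x"
      by (simp add: rho_eq power2_eq_square mult_ac)
    then show ?thesis
      using grad_real_compose[OF p_C1 dP] by (simp add: Psi_sq p_deriv)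
  qed

  \<comment> \<open>Behaviour at infinity\<close>
  obtain r where r: "\<And>x. x \<in> closure {x. U x \<noteq> 0} \<Longrightarrow> norm x \<le> r"
    using compact_imp_bounded[OF \<open>compact (closure {x. U x \<noteq> 0})\<close>] unfolding bounded_iff by blast
  have U_zero: "U x = 0" if "r < norm x" for x
  proof (rule ccontr)
    assume "U x \<noteq> 0"
    then have "x \<in> closure {x. U x \<noteq> 0}" by (intro subsetD[OF closure_subset]) simp
    then show False using that r by fastforce
  qed
  have "grad P x = 0" if "r < norm x" for x
    using euler[of x] U_zero[OF that] by (simp add: convective_def)
  then obtain c where c: "\<And>x. r < norm x \<Longrightarrow> P x = c"
    using grad_zero_outside_ball_imp_constant[of P r] dP by auto
  have far: "\<forall>\<^sub>F x in at_infinity. r < norm (x :: real^3)"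
    by (rule eventually_at_infinityI[of "r + 1"]) simp
  have "(P \<longlongrightarrow> c) at_infinity"
    using far by (rule tendsto_eventually[OF eventually_mono]) (rule c)
  \<comment> \<open>\<open>Lim\<close> is a choice operator, so it is identified only after
    convergence has been shown.\<close>
  then have c_eq: "c = P_inf"
    using tendsto_Lim[OF trivial_limit_at_infinity, of P c] \<open>P_inf = Lim at_infinity P\<close> by simp
  \<comment> \<open>Far out \<open>P\<close> equals \<open>P_inf\<close> exactly, and
    \<open>high\<close> includes this endpoint.\<close>
  have rho_lim: "(\<rho> \<longlongrightarrow> rho_inf) at_infinity"
    using far by (rule tendsto_eventually[OF eventually_mono]) (simp add: rho_eq c c_eq high)
  have u_lim: "(u \<longlongrightarrow> 0) at_infinity"
    using far by (rule tendsto_eventually[OF eventually_mono]) (simp add: u_eq U_zero)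

  have "isentropic_Euler (\<lambda>r. pressure \<gamma> a r s_inf) \<rho> u"
    using isentropic_Euler_iff[OF rho_C1 u_C1 div_rho_u] momentum by (simp add: p_def rho_eq)
  \<comment> \<open>The isentropic pressure itself serves as the scalar pressure.\<close>
  moreover have "nonhomogeneous_incompressible_Euler \<rho> u (\<lambda>x. p (P x))"
    unfolding nonhomogeneous_incompressible_Euler_def
    using rho_C1 u_C1 q_C1 div_u div_rho_u momentum by blast
  ultimately show ?thesis using rho_lim u_lim div_u conv_rho by blast
qed

end
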